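(* Let $F:\mathbb{R}^N\to\mathbb{R}^N$ be a locally Lipschitz continuous mapping that, for every $R>0$, defines a quasi-gradient vector field on $\overline B(0,R)$ for one and the same function $E\in C^2(\mathbb{R}^N;\mathbb{R})$. Assume that $E$ is a KL function and that for every $R>0$ there exists $b>0$ such that $$\|\nabla E(u)\|\le b\,\|F(u)\|\quad\text{for every }u\in\overline B(0,R).$$ Assume further that, for a given $u_0\in\mathbb{R}^N$, the solution $u:[0,\infty)\to\mathbb{R}^N$ to $u'(t)+F(u(t))=0$, $u(0)=u_0$, converges as $t\to\infty$ to some rest point $u_\infty$ of $F$. Let $\varphi:[0,r_0)\to\mathbb{R}_+$ be a desingularizing function of $E$ at $u_\infty$ such that, for some $c_0>0$, $\varphi'(s)\ge c_0/\sqrt{s}$ on $(0,r_0)$; let $\psi=\varphi^{-1}$, with domain $[0,a)$, $a\in(0,\infty]$, and let $\nu:[0,\infty)\to(0,a)$ be a solution to $$\nu'(t)+\psi'(\nu(t))=0,\quad \nu(0)=\nu_0\in(0,a).$$ Then there exist constants $c,d>0$ and $t_0\in\mathbb{R}$ such that $$\|u(t)-u_\infty\|\le d\,\nu(ct+t_0)$$ for all sufficiently large $t$.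
   Context: $\overline B(0,R)$ is the closed Euclidean ball. Quasi-gradient field: given a nonempty closed set $\Gamma\subset\mathbb{R}^N$ and a locally Lipschitz $F:\mathbb{R}^N\to\mathbb{R}^N$, $F$ is quasi-gradient on $\Gamma$ for a differentiable function $E:\mathbb{R}^N\to\mathbb{R}$ if there is $\alpha=\alpha_\Gamma>0$ such that (angle condition) $\langle\nabla E(u),F(u)\rangle\ge\alpha\|\nabla E(u)\|\,\|F(u)\|$ for every $u\in\Gamma$, and (rest-points equivalence) $\operatorname{crit}E\cap\Gamma=F^{-1}(\{0\})\cap\Gamma$, where $\operatorname{crit}E=\{\nabla E=0\}$. KL property and desingularizing function: a differentiable $E:\mathbb{R}^N\to\mathbb{R}$ has the KL property at $\bar u$ if there exist $r_0>0$, $\eta>0$ and $\varphi\in C([0,r_0);\mathbb{R}_+)$ such that (1) $\varphi(0)=0$, $\varphi$ is $C^1$ on $(0,r_0)$, concave, with $\varphi'>0$ on $(0,r_0)$; (2) $|E(u)-E(\bar u)|<r_0$ for all $u\in B(\bar u,\eta)$ (open ball), and $\|\nabla(\varphi\circ|E(\cdot)-E(\bar u)|)(u)\|\ge1$ for each $u\in B(\bar u,\eta)$ with $E(u)\ne E(\bar u)$. Such a $\varphi$ is called a desingularizing function of $E$ at $\bar u$. $E$ is a KL function if it has the KL property at every point of $\mathbb{R}^N$. The lower bound on $\varphi'$ guarantees that solutions $\nu$ of the one-dimensional system are defined on $[0,\infty)$, remain positive and tend to $0$. *)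

theory Defs
  imports "HOL-Analysis.Analysis"
begin

text \<open>Meaningful only where \<open>f\<close> is differentiable; see \<open>GDERIV_grad\<close> below.\<close>

definition grad :: "('a::euclidean_space \<Rightarrow> real) \<Rightarrow> 'a \<Rightarrow> 'a" where
  "grad f x = (THE D. GDERIV f x :> D)"

lemma grad_eqI:
  assumes "GDERIV f x :> D"
  shows "grad f x = D"
  unfolding grad_def
proof (rule the_equality[where P = "\<lambda>D. GDERIV f x :> D"])
  fix D' assume "GDERIV f x :> D'"
  then have "(\<lambda>h. inner h D') = (\<lambda>h. inner h D)"
    using assms unfolding gderiv_def by (rule has_derivative_unique)
  then show "D' = D"
    by (metis inner_commute vector_eq_rdot)
qed (rule assms)

lemma GDERIV_grad:
  fixes f :: "'a::euclidean_space \<Rightarrow> real"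
  assumes "f differentiable (at x)"
  shows "GDERIV f x :> grad f x"
proof -
  obtain f' where f': "(f has_derivative f') (at x)"
    using assms unfolding differentiable_def by blast
  then interpret linear f' by (rule has_derivative_linear)
  have "f' h = inner h (\<Sum>b\<in>Basis. f' b *\<^sub>R b)" for h
  proof -
    have "f' h = f' (\<Sum>b\<in>Basis. inner h b *\<^sub>R b)"
      by (simp add: euclidean_representation)
    then show ?thesis
      by (simp add: sum scale inner_sum_right mult.commute)
  qed
  then have "f' = (\<lambda>h. inner h (\<Sum>b\<in>Basis. f' b *\<^sub>R b))" by blast
  then have "GDERIV f x :> (\<Sum>b\<in>Basis. f' b *\<^sub>R b)"
    using f' unfolding gderiv_def by metis
  then show ?thesis using grad_eqI by metis
qed

text \<open>\<open>H x\<close> is the Hessian at \<open>x\<close>, and continuity is with respect to the operator norm.\<close>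

definition C2 :: "('a::euclidean_space \<Rightarrow> real) \<Rightarrow> bool" where
  "C2 f \<longleftrightarrow> (\<forall>x. f differentiable (at x)) \<and>
     (\<exists>H :: 'a \<Rightarrow> 'a \<Rightarrow>\<^sub>L 'a.
        (\<forall>x. (grad f has_derivative blinfun_apply (H x)) (at x)) \<and> continuous_on UNIV H)"

text \<open>The library notion is for time-dependent maps, whence the dummy time argument.\<close>

definition locally_lipschitz :: "('a::metric_space \<Rightarrow> 'b::metric_space) \<Rightarrow> bool" where
  "locally_lipschitz F \<longleftrightarrow> local_lipschitz (UNIV :: real set) UNIV (\<lambda>_. F)"

definition quasi_gradient_on ::
    "'a set \<Rightarrow> ('a::euclidean_space \<Rightarrow> 'a) \<Rightarrow> ('a \<Rightarrow> real) \<Rightarrow> bool" where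
  "quasi_gradient_on \<Gamma> F E \<longleftrightarrow>
     \<Gamma> \<noteq> {} \<and> closed \<Gamma> \<and> locally_lipschitz F \<and> (\<forall>u. E differentiable (at u)) \<and>
     (\<exists>\<alpha>>0. \<forall>u\<in>\<Gamma>. inner (grad E u) (F u) \<ge> \<alpha> * norm (grad E u) * norm (F u)) \<and>
     {u. grad E u = 0} \<inter> \<Gamma> = F -` {0} \<inter> \<Gamma>"

text \<open>A function on \<open>[0, r0)\<close> is represented by a total function whose values elsewhere are
  irrelevant. In the last clause \<open>0 < \<bar>E u - E z\<bar> < r0\<close>, so the composition is differentiable
  at \<open>u\<close> whenever \<open>E\<close> is.\<close>

definition desingularizing ::
    "('a::euclidean_space \<Rightarrow> real) \<Rightarrow> 'a \<Rightarrow> real \<Rightarrow> (real \<Rightarrow> real) \<Rightarrow> bool" where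
  "desingularizing E z r0 \<phi> \<longleftrightarrow>
     r0 > 0 \<and>
     continuous_on {0..<r0} \<phi> \<and> (\<forall>s\<in>{0..<r0}. \<phi> s \<ge> 0) \<and>
     \<phi> 0 = 0 \<and>
     (\<forall>s\<in>{0<..<r0}. \<phi> differentiable (at s)) \<and> continuous_on {0<..<r0} (deriv \<phi>) \<and>
     concave_on {0..<r0} \<phi> \<and>
     (\<forall>s\<in>{0<..<r0}. deriv \<phi> s > 0) \<and>
     (\<exists>\<eta>>0. (\<forall>u\<in>ball z \<eta>. \<bar>E u - E z\<bar> < r0) \<and>
            (\<forall>u\<in>ball z \<eta>. E u \<noteq> E z \<longrightarrow> norm (grad (\<lambda>v. \<phi> \<bar>E v - E z\<bar>) u) \<ge> 1))"

definition KL_property :: "('a::euclidean_space \<Rightarrow> real) \<Rightarrow> 'a \<Rightarrow> bool" where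
  "KL_property E z \<longleftrightarrow>
     (\<forall>u. E differentiable (at u)) \<and> (\<exists>r0 \<phi>. desingularizing E z r0 \<phi>)"

definition KL_function :: "('a::euclidean_space \<Rightarrow> real) \<Rightarrow> bool" where
  "KL_function E \<longleftrightarrow> (\<forall>z. KL_property E z)"

end

theory Submission
  imports Defs
begin

text \<open>Put \<open>e t = E (u t) - E u_inf\<close>, which decreases to \<open>0\<close>. If it vanishes at some time, the angle
  condition and the rest-points equivalence make \<open>u\<close> stationary from then on. Otherwise let
  \<open>z = \<phi> \<circ> e\<close>. The angle condition and the KL inequality \<open>\<phi>' (e) * \<parallel>grad E (u)\<parallel> \<ge> 1\<close> give
  \<open>z' \<le> - \<alpha> * \<parallel>F (u)\<parallel>\<close>, hence \<open>\<parallel>u - u_inf\<parallel> \<le> z / \<alpha>\<close>; together with \<open>\<parallel>grad E\<parallel> \<le> b * \<parallel>F\<parallel>\<close> they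
  also give \<open>z' \<le> - (\<alpha> / b) * \<psi>' (z)\<close>. As \<open>\<psi>'\<close> is nondecreasing, \<open>z\<close> stays below the solution
  \<open>\<nu> ((\<alpha> / b) * (t - T))\<close> of the corresponding equation as soon as \<open>z T \<le> \<nu> 0\<close>, which holds for
  large \<open>T\<close> because \<open>z\<close> tends to \<open>0\<close>.\<close>

text \<open>Adding the tangent inequalities of the convex function \<open>- f\<close> at
  \<open>x\<close> and at \<open>y\<close> gives
  \<open>(deriv f x - deriv f y) * (y - x) \<ge> 0\<close>.\<close>

lemma concave_on_deriv_antimono:
  fixes f :: "real \<Rightarrow> real"
  assumes f: "concave_on A f" and A: "connected A"
    and x: "x \<in> interior A" "f differentiable (at x)"
    and y: "y \<in> interior A" "f differentiable (at y)"
    and "x \<le> y"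
  shows "deriv f y \<le> deriv f x"
proof -
  have tangent: "- f q - (- f p) \<ge> - deriv f p * (q - p)"
    if "p \<in> interior A" "q \<in> A" "f differentiable (at p)" for p q
  proof (rule convex_on_imp_above_tangent[OF _ A])
    show "convex_on A (\<lambda>x. - f x)"
      using f by (simp add: concave_on_def)
    have "(f has_real_derivative deriv f p) (at p within A)"
      using that(3) by (simp add: DERIV_deriv_iff_real_differentiable has_field_derivative_at_within)
    then show "((\<lambda>x. - f x) has_real_derivative - deriv f p) (at p within A)"
      by (rule DERIV_minus)
  qed (use that in auto)
  have "x \<in> A" "y \<in> A"
    using x y interior_subset by auto
  then have "0 \<le> deriv f x * (y - x) + deriv f y * (x - y)"
    using tangent[of x y] tangent[of y x] x y by linarith
  then have "0 \<le> (deriv f x - deriv f y) * (y - x)"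
    by argo
  then show ?thesis
    using \<open>x \<le> y\<close> by (cases "x = y") (auto simp: zero_le_mult_iff)
qed

text \<open>Comparison principle, to be applied to the difference of a subsolution and a solution.
  If \<open>w t > 0\<close>, then \<open>w\<close> is positive after the last time
  \<open>Sup S\<close> in \<open>{T..t}\<close> at which \<open>w \<le> 0\<close>, hence
  nonincreasing from there to \<open>t\<close>, which contradicts
  \<open>w (Sup S) \<le> 0\<close>.\<close>

lemma deriv_nonpos_where_pos_imp_nonpos:
  fixes w w' :: "real \<Rightarrow> real"
  assumes cont: "continuous_on {T..} w"
    and der: "\<And>t. t > T \<Longrightarrow> (w has_real_derivative w' t) (at t)"
    and nonpos: "\<And>t. t > T \<Longrightarrow> w t > 0 \<Longrightarrow> w' t \<le> 0"
    and init: "w T \<le> 0" and "T \<le> t"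
  shows "w t \<le> 0"
proof (rule ccontr)
  assume pos: "\<not> w t \<le> 0"
  define S where "S = {s \<in> {T..t}. w s \<le> 0}"
  have "continuous_on {T..t} w"
    using cont by (rule continuous_on_subset) auto
  then have "closed ({T..t} \<inter> w -` {..0})"
    by (rule continuous_closed_preimage) auto
  moreover have "S = {T..t} \<inter> w -` {..0}"
    by (auto simp: S_def)
  ultimately have "closed S"
    by simp
  moreover have "S \<noteq> {}" "bdd_above S"
    using init \<open>T \<le> t\<close> by (auto simp: S_def)
  ultimately have s: "Sup S \<in> S"
    by (intro closed_contains_Sup)
  then have "Sup S < t"
    using pos by (cases "Sup S = t") (auto simp: S_def)
  have *: "w v > 0" if "Sup S < v" "v \<le> t" for v
  proof (rule ccontr)
    assume "\<not> w v > 0"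
    then have "v \<in> S"
      using that s by (auto simp: S_def)
    then show False
      using cSup_upper[OF _ \<open>bdd_above S\<close>] that by fastforce
  qed
  have "w t \<le> w (Sup S)"
  proof (rule DERIV_nonpos_imp_decreasing_open[OF less_imp_le[OF \<open>Sup S < t\<close>]])
    show "continuous_on {Sup S..t} w"
      using cont s by (elim continuous_on_subset) (auto simp: S_def)
    show "\<exists>y. (w has_real_derivative y) (at v) \<and> y \<le> 0" if "Sup S < v" "v < t" for v
      using der[of v] nonpos[of v] *[of v] that s by (auto simp: S_def)
  qed
  then show False
    using s pos by (auto simp: S_def)
qed

section \<open>Desingularizing functions and their inverses\<close>

context
  fixes E :: "'a::euclidean_space \<Rightarrow> real" and z r0 \<phi>
  assumes desing: "desingularizing E z r0 \<phi>"
begin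

lemma desingularizing_DERIV:
  assumes "s \<in> {0<..<r0}"
  shows "(\<phi> has_real_derivative deriv \<phi> s) (at s)"
  using desing assms
  by (auto simp: desingularizing_def DERIV_deriv_iff_real_differentiable)

lemma desingularizing_deriv_pos: "s \<in> {0<..<r0} \<Longrightarrow> deriv \<phi> s > 0"
  using desing by (auto simp: desingularizing_def)

lemma desingularizing_strict_mono: "strict_mono_on {0..<r0} \<phi>"
proof (rule strict_mono_onI)
  fix x y assume "x \<in> {0..<r0}" "y \<in> {0..<r0}" "x < y"
  then show "\<phi> x < \<phi> y"
  proof (intro DERIV_pos_imp_increasing_open[of x y \<phi>])
    show "continuous_on {x..y} \<phi>"
      using desing \<open>x \<in> {0..<r0}\<close> \<open>y \<in> {0..<r0}\<close> unfolding desingularizing_def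
      by (auto elim: continuous_on_subset)
    show "\<exists>d. (\<phi> has_real_derivative d) (at s) \<and> d > 0" if "x < s" "s < y" for s
      using desingularizing_DERIV[of s] desingularizing_deriv_pos[of s] that
        \<open>x \<in> {0..<r0}\<close> \<open>y \<in> {0..<r0}\<close> by auto
  qed
qed

lemma desingularizing_deriv_antimono:
  assumes "x \<in> {0<..<r0}" "y \<in> {0<..<r0}" "x \<le> y"
  shows "deriv \<phi> y \<le> deriv \<phi> x"
proof (rule concave_on_deriv_antimono)
  show "concave_on {0..<r0} \<phi>"
    using desing by (simp add: desingularizing_def)
  show "x \<in> interior {0..<r0}" "y \<in> interior {0..<r0}"
    using assms by simp_all
qed (use assms desing in \<open>auto simp: desingularizing_def\<close>)

text \<open>One-dimensional inverse function rule on the open interval \<open>{0<..<r0}\<close>,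
  where \<open>deriv \<phi>\<close> is positive. The left-inverse property there comes from strict
  monotonicity of \<open>\<phi>\<close>.\<close>

lemma deriv_the_inv_into_desingularizing:
  assumes "s \<in> {0<..<r0}"
  shows "deriv (the_inv_into {0..<r0} \<phi>) (\<phi> s) = inverse (deriv \<phi> s)"
proof (rule DERIV_imp_deriv, unfold has_field_derivative_def,
    rule has_derivative_inverse_strong[where S = "{0<..<r0}" and f = \<phi> and x = s])
  show "(\<phi> has_derivative (*) (deriv \<phi> s)) (at s)"
    using desingularizing_DERIV[OF assms] by (simp add: has_field_derivative_def)
  show "(*) (deriv \<phi> s) \<circ> (*) (inverse (deriv \<phi> s)) = id"
    using desingularizing_deriv_pos[OF assms] by (auto simp: fun_eq_iff)
  show "continuous_on {0<..<r0} \<phi>"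
    using desing unfolding desingularizing_def by (auto elim: continuous_on_subset)
  show "the_inv_into {0..<r0} \<phi> (\<phi> x) = x" if "x \<in> {0<..<r0}" for x
    using that strict_mono_on_imp_inj_on[OF desingularizing_strict_mono]
    by (intro the_inv_into_f_f) auto
qed (use assms in auto)

text \<open>Concavity of \<open>\<phi>\<close> turns into convexity of its inverse: from
  \<open>x\<close> to \<open>y\<close> the slope of \<open>\<phi>\<close> falls, so its reciprocal,
  the slope of the inverse, rises.\<close>

lemma deriv_the_inv_into_desingularizing_mono:
  assumes "x \<in> {0<..<r0}" "y \<in> {0<..<r0}" "\<phi> x \<le> \<phi> y"
  shows "deriv (the_inv_into {0..<r0} \<phi>) (\<phi> x) \<le> deriv (the_inv_into {0..<r0} \<phi>) (\<phi> y)"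
proof -
  have "x \<le> y"
    using strict_mono_onD[OF desingularizing_strict_mono, of y x] assms by force
  then have "deriv \<phi> y \<le> deriv \<phi> x"
    using assms by (intro desingularizing_deriv_antimono)
  then show ?thesis
    using assms desingularizing_deriv_pos[of y]
    by (simp add: deriv_the_inv_into_desingularizing le_imp_inverse_le)
qed

text \<open>Above the level \<open>E z\<close> the absolute value is locally the identity, so the
  chain rule gives the gradient \<open>deriv \<phi> (E x - E z) *\<^sub>R grad E x\<close>; its
  scalar factor is positive and leaves the norm unchanged in sign.\<close>

lemma norm_grad_desingularized:
  assumes "E differentiable (at x)" "E x > E z" "E x - E z < r0"
  shows "norm (grad (\<lambda>v. \<phi> \<bar>E v - E z\<bar>) x) = deriv \<phi> (E x - E z) * norm (grad E x)"
proof -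
  let ?e = "E x - E z"
  have e: "?e \<in> {0<..<r0}"
    using assms by auto
  have abs: "((\<lambda>s. \<phi> \<bar>s\<bar>) has_real_derivative deriv \<phi> ?e) (at ?e)"
  proof (rule has_field_derivative_transform_within_open[where S = "{0<..}"])
    show "(\<phi> has_real_derivative deriv \<phi> ?e) (at ?e)"
      using e by (rule desingularizing_DERIV)
  qed (use e in auto)
  have "((\<lambda>v. E v - E z) has_derivative (\<lambda>h. inner h (grad E x))) (at x)"
    using GDERIV_grad[OF assms(1)] unfolding gderiv_def
    by (auto intro!: derivative_eq_intros)
  then have "GDERIV (\<lambda>v. \<phi> \<bar>E v - E z\<bar>) x :> deriv \<phi> ?e *\<^sub>R grad E x"
    using has_derivative_compose[of "\<lambda>v. E v - E z" _ x UNIV "\<lambda>s. \<phi> \<bar>s\<bar>",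
        OF _ abs[unfolded has_field_derivative_def]]
    by (simp add: gderiv_def)
  then show ?thesis
    using desingularizing_deriv_pos[OF e] by (simp add: grad_eqI)
qed

end

theorem theorem3p7:
  fixes F :: "real ^ 'n \<Rightarrow> real ^ 'n"
    and E :: "real ^ 'n \<Rightarrow> real"
    and u :: "real \<Rightarrow> real ^ 'n"
    and u0 u_inf :: "real ^ 'n"
    and \<phi> \<psi> \<nu> :: "real \<Rightarrow> real"
    and r0 c0 \<nu>0 :: real
    and a :: ereal
  assumes "locally_lipschitz F"
    and "C2 E"
    and "\<And>R. R > 0 \<Longrightarrow> quasi_gradient_on (cball 0 R) F E"
    and "KL_function E"
    and "\<And>R. R > 0 \<Longrightarrow> \<exists>b>0. \<forall>x\<in>cball 0 R. norm (grad E x) \<le> b * norm (F x)"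
    and "u 0 = u0"
    and "\<And>t. t \<ge> 0 \<Longrightarrow> (u has_vector_derivative - F (u t)) (at t within {0..})"
    and "(u \<longlongrightarrow> u_inf) at_top"
    and "F u_inf = 0"
    and "desingularizing E u_inf r0 \<phi>"
    and "c0 > 0"
    and "\<And>s. s \<in> {0<..<r0} \<Longrightarrow> deriv \<phi> s \<ge> c0 / sqrt s"
    and "\<psi> = the_inv_into {0..<r0} \<phi>"
    and "a > 0"
    and "\<phi> ` {0..<r0} = {x. 0 \<le> x \<and> ereal x < a}"
    and "0 < \<nu>0" and "ereal \<nu>0 < a"
    and "\<nu> 0 = \<nu>0"
    and "\<And>t. t \<ge> 0 \<Longrightarrow> 0 < \<nu> t \<and> ereal (\<nu> t) < a"
    and "\<And>t. t \<ge> 0 \<Longrightarrow> (\<nu> has_real_derivative - deriv \<psi> (\<nu> t)) (at t within {0..})"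
  shows "\<exists>c>0. \<exists>d>0. \<exists>t0::real.
           eventually (\<lambda>t. norm (u t - u_inf) \<le> d * \<nu> (c * t + t0)) at_top"
proof -
  note desing = \<open>desingularizing E u_inf r0 \<phi>\<close>

  \<comment> \<open>Constants valid near the limit point\<close>
  define e where "e t = E (u t) - E u_inf" for t
  have diffE: "E differentiable (at x)" for x
    using \<open>C2 E\<close> by (simp add: C2_def)
  obtain \<eta> where "\<eta> > 0"
    and small: "\<And>x. x \<in> ball u_inf \<eta> \<Longrightarrow> \<bar>E x - E u_inf\<bar> < r0"
    and KL: "\<And>x. x \<in> ball u_inf \<eta> \<Longrightarrow> E x \<noteq> E u_inf \<Longrightarrow>
      norm (grad (\<lambda>v. \<phi> \<bar>E v - E u_inf\<bar>) x) \<ge> 1"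
    using desing unfolding desingularizing_def by blast
  \<comment> \<open>This radius makes \<open>cball 0 R\<close> contain the KL neighbourhood
    \<open>ball u_inf \<eta>\<close>, so that \<open>\<alpha>\<close> and \<open>b\<close> can be
    used there.\<close>
  define R where "R = norm u_inf + \<eta>"
  have "R > 0"
    using \<open>\<eta> > 0\<close> by (simp add: R_def add_nonneg_pos)
  have ball: "x \<in> cball 0 R" if "x \<in> ball u_inf \<eta>" for x
    using that norm_triangle_ineq2[of x u_inf] by (auto simp: R_def dist_norm norm_minus_commute)
  obtain \<alpha> where "\<alpha> > 0"
    and angle: "\<And>x. x \<in> cball 0 R \<Longrightarrow> inner (grad E x) (F x) \<ge> \<alpha> * norm (grad E x) * norm (F x)"
    and rest: "\<And>x. x \<in> cball 0 R \<Longrightarrow> grad E x = 0 \<longleftrightarrow> F x = 0"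
    using assms(3)[OF \<open>R > 0\<close>] unfolding quasi_gradient_on_def by blast
  obtain b where "b > 0" and b: "\<And>x. x \<in> cball 0 R \<Longrightarrow> norm (grad E x) \<le> b * norm (F x)"
    using assms(5)[OF \<open>R > 0\<close>] by blast
  have "\<forall>\<^sub>F t in at_top. u t \<in> ball u_inf \<eta>"
    using tendstoD[OF \<open>(u \<longlongrightarrow> u_inf) at_top\<close> \<open>\<eta> > 0\<close>] by (simp add: dist_commute)
  then obtain T0 where T0: "\<And>t. t \<ge> T0 \<Longrightarrow> u t \<in> ball u_inf \<eta>"
    by (auto simp: eventually_at_top_linorder)
  \<comment> \<open>Staying above 1 keeps times in the interior of \<open>{0..}\<close>, where
    one-sided derivatives are two-sided.\<close>
  define T1 where "T1 = max 1 T0"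
  have ball_u: "u t \<in> ball u_inf \<eta>" "u t \<in> cball 0 R" if "t \<ge> T1" for t
    using T0[of t] ball that by (auto simp: T1_def)
  have der_u: "(u has_vector_derivative - F (u t)) (at t)" if "t \<ge> T1" for t
    using assms(7)[of t] that at_within_interior[of t "{0..}"] by (simp add: T1_def)

  \<comment> \<open>Decay of the energy along the trajectory\<close>
  have der_e: "(e has_real_derivative - inner (grad E (u t)) (F (u t))) (at t)" if "t \<ge> T1" for t
  proof -
    have "((\<lambda>t. E (u t)) has_derivative (\<lambda>h. inner (h *\<^sub>R - F (u t)) (grad E (u t)))) (at t)"
      using has_derivative_compose[OF der_u[OF that, unfolded has_vector_derivative_def]
          GDERIV_grad[OF diffE, unfolded gderiv_def]] .
    then show ?thesis
      unfolding e_def[abs_def] has_field_derivative_def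
      by (auto intro!: derivative_eq_intros simp: inner_commute fun_eq_iff)
  qed
  have decr: "- inner (grad E (u t)) (F (u t)) \<le> 0" if "t \<ge> T1" for t
  proof -
    have "0 \<le> \<alpha> * norm (grad E (u t)) * norm (F (u t))"
      using \<open>\<alpha> > 0\<close> by simp
    then show ?thesis
      using angle[OF ball_u(2)[OF that]] by linarith
  qed
  have mono_e: "e t \<le> e s" if "T1 \<le> s" "s \<le> t" for s t
  proof (rule DERIV_nonpos_imp_nonincreasing[OF \<open>s \<le> t\<close>])
    show "\<exists>y. (e has_real_derivative y) (at x) \<and> y \<le> 0" if "s \<le> x" "x \<le> t" for x
      using der_e[of x] decr[of x] \<open>T1 \<le> s\<close> that by (intro exI conjI) auto
  qed
  have "isCont E u_inf"
    using diffE differentiable_imp_continuous_within by blast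
  then have "((\<lambda>t. E (u t)) \<longlongrightarrow> E u_inf) at_top"
    using \<open>(u \<longlongrightarrow> u_inf) at_top\<close> by (rule isCont_tendsto_compose)
  then have lim_e: "(e \<longlongrightarrow> 0) at_top"
    unfolding e_def[abs_def] by (simp add: LIM_zero)
  \<comment> \<open>A nonincreasing function lies above its limit.\<close>
  have e_nonneg: "0 \<le> e t" if "t \<ge> T1" for t
    using mono_e that
    by (intro tendsto_upperbound[OF lim_e]) (auto simp: eventually_at_top_linorder)
  show ?thesis
  \<comment> \<open>The chain rule for \<open>\<phi> (e t)\<close> is available only while
    \<open>e t > 0\<close>, so a zero of \<open>e\<close> is treated separately.\<close>
  proof (cases "\<exists>t1\<ge>T1. e t1 = 0")
    case True
    then obtain t1 where t1: "t1 \<ge> T1" "e t1 = 0"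
      by blast
    have e0: "e t = 0" if "t \<ge> t1" for t
      using mono_e[of t1 t] e_nonneg[of t] t1 that by auto
    \<comment> \<open>Since \<open>e\<close> vanishes on the open set \<open>{t1<..}\<close>, so
      does its derivative. The angle condition then kills \<open>grad E\<close> or \<open>F\<close>,
      and the rest-points equivalence gives \<open>F = 0\<close> in either case.\<close>
    have F0: "F (u t) = 0" if "t > t1" for t
    proof -
      have "(e has_real_derivative 0) (at t)"
        by (rule has_field_derivative_transform_within_open[where S = "{t1<..}" and f = "\<lambda>_. 0"])
          (use that e0 in auto)
      then have "inner (grad E (u t)) (F (u t)) = 0"
        using DERIV_unique[OF der_e[of t], of 0] t1 that by simp
      then have "\<alpha> * norm (grad E (u t)) * norm (F (u t)) \<le> 0"
        using angle[OF ball_u(2)[of t]] t1 that by simp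
      then have "grad E (u t) = 0 \<or> F (u t) = 0"
        using \<open>\<alpha> > 0\<close> by (auto simp: mult_le_0_iff)
      then show ?thesis
        using rest[OF ball_u(2)[of t]] t1 that by auto
    qed
    have const: "u s = u t" if "t1 < t" "t < s" for s t
    proof -
      have "norm (u s - u t) \<le> 0 - (0::real)"
      proof (rule differentiable_bound_general[OF \<open>t < s\<close>, of u "\<lambda>_. 0" "\<lambda>_. 0" "\<lambda>_. 0"])
        have "u differentiable (at x)" if "x \<in> {t..s}" for x
          using der_u[of x] that \<open>t1 < t\<close> t1 differentiableI_vector by auto
        then show "continuous_on {t..s} u"
          by (auto intro!: continuous_at_imp_continuous_on differentiable_imp_continuous_within)
        show "(u has_vector_derivative 0) (at x)" if "t < x" "x < s" for x
          using der_u[of x] F0[of x] that \<open>t1 < t\<close> t1 by auto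
      qed auto
      then show ?thesis
        by simp
    qed
    have u_eq: "u t = u_inf" if "t > t1" for t
    proof (rule tendsto_unique[OF trivial_limit_at_top_linorder _ \<open>(u \<longlongrightarrow> u_inf) at_top\<close>])
      have "\<forall>\<^sub>F s in at_top. u s = u t"
        using eventually_gt_at_top[of t] by eventually_elim (use const that in auto)
      then show "(u \<longlongrightarrow> u t) at_top"
        by (rule tendsto_eventually)
    qed
    \<comment> \<open>The left side is eventually 0 and \<open>\<nu>\<close> is positive on
      \<open>{0..}\<close>, so the constants 1, 1 and 0 suffice.\<close>
    have "\<forall>\<^sub>F t in at_top. norm (u t - u_inf) \<le> 1 * \<nu> (1 * t + 0)"
      using eventually_gt_at_top[of t1] eventually_ge_at_top[of 0]
      by eventually_elim (use u_eq assms(19) in \<open>auto intro: less_imp_le\<close>)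
    then show ?thesis
      using zero_less_one by blast
  next
    case False
    have e_in: "e t \<in> {0<..<r0}" if "t \<ge> T1" for t
      using e_nonneg[OF that] False that small[OF ball_u(1)[OF that]]
      by (force simp: e_def)

    \<comment> \<open>The desingularized energy along the trajectory\<close>
    define z where "z t = \<phi> (e t)" for t
    define z' where "z' t = - (deriv \<phi> (e t) * inner (grad E (u t)) (F (u t)))" for t
    have der_z: "(z has_real_derivative z' t) (at t)" if "t \<ge> T1" for t
      using DERIV_chain2[OF desingularizing_DERIV[OF desing e_in[OF that]] der_e[OF that]]
      by (simp add: z_def[abs_def] z'_def)
    have z_pos: "z t > 0" if "t \<ge> T1" for t
      using strict_mono_onD[OF desingularizing_strict_mono[OF desing], of 0 "e t"] e_in[OF that] desing
      by (auto simp: z_def desingularizing_def)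
    have KL_u: "1 \<le> deriv \<phi> (e t) * norm (grad E (u t))" if "t \<ge> T1" for t
      using KL[OF ball_u(1)[OF that]] norm_grad_desingularized[OF desing diffE, of "u t"] e_in[OF that]
      by (auto simp: e_def)
    \<comment> \<open>The product \<open>deriv \<phi> (e t) * norm (grad E (u t))\<close> is kept
      together because \<open>KL_u\<close> bounds it below by 1.\<close>
    have z'_angle: "z' t \<le> - (\<alpha> * (deriv \<phi> (e t) * norm (grad E (u t))) * norm (F (u t)))"
      if "t \<ge> T1" for t
      using mult_left_mono[OF angle[OF ball_u(2)[OF that]],
          OF less_imp_le[OF desingularizing_deriv_pos[OF desing e_in[OF that]]]]
      by (simp add: z'_def mult_ac)
    have z'_F: "z' t \<le> - (\<alpha> * norm (F (u t)))" if "t \<ge> T1" for t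
    proof -
      have "\<alpha> * 1 * norm (F (u t)) \<le> \<alpha> * (deriv \<phi> (e t) * norm (grad E (u t))) * norm (F (u t))"
        using KL_u[OF that] \<open>\<alpha> > 0\<close> by (intro mult_right_mono mult_left_mono) auto
      then show ?thesis
        using z'_angle[OF that] by simp
    qed
    define c where "c = \<alpha> / b"
    have "c > 0"
      using \<open>\<alpha> > 0\<close> \<open>b > 0\<close> by (simp add: c_def)
    \<comment> \<open>Through the inverse rule the KL inequality reads
      \<open>deriv \<psi> (z t) \<le> norm (grad E (u t))\<close>, which is at most
      \<open>b * norm (F (u t))\<close>; the factor \<open>c = \<alpha> / b\<close> matches this
      with \<open>z'_F\<close>.\<close>
    have z'_\<psi>: "z' t \<le> - (c * deriv \<psi> (z t))" if "t \<ge> T1" for t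
    proof -
      have "deriv \<psi> (z t) = inverse (deriv \<phi> (e t))"
        using deriv_the_inv_into_desingularizing[OF desing e_in[OF that]] assms(13)
        by (simp add: z_def)
      also have "\<dots> \<le> norm (grad E (u t))"
        using KL_u[OF that] desingularizing_deriv_pos[OF desing e_in[OF that]]
        by (simp add: field_simps)
      also have "\<dots> \<le> b * norm (F (u t))"
        by (rule b[OF ball_u(2)[OF that]])
      finally have "c * deriv \<psi> (z t) \<le> c * (b * norm (F (u t)))"
        using \<open>c > 0\<close> by simp
      then show ?thesis
        using z'_F[OF that] \<open>b > 0\<close> by (simp add: c_def)
    qed
    have cont_z: "continuous_on {s..} z" if "s \<ge> T1" for s
      by (rule DERIV_continuous_on, rule has_field_derivative_at_within, rule der_z) (use that in auto)
    \<comment> \<open>The speed \<open>norm (F (u t))\<close> is at most the derivative of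
      \<open>- z t / \<alpha>\<close>, so the mean value inequality bounds
      \<open>norm (u s - u t)\<close> by \<open>(z t - z s) / \<alpha>\<close>. Dropping
      \<open>z s > 0\<close> and letting \<open>s\<close> tend to infinity gives the claim.\<close>
    have dist_z: "norm (u t - u_inf) \<le> z t / \<alpha>" if "t \<ge> T1" for t
    proof (rule tendsto_upperbound[OF _ _ trivial_limit_at_top_linorder])
      show "((\<lambda>s. norm (u t - u s)) \<longlongrightarrow> norm (u t - u_inf)) at_top"
        using \<open>(u \<longlongrightarrow> u_inf) at_top\<close> by (intro tendsto_intros)
      have "norm (u t - u s) \<le> z t / \<alpha>" if "t < s" for s
      proof -
        have "norm (u s - u t) \<le> - z s / \<alpha> - (- z t / \<alpha>)"
        proof (rule differentiable_bound_general[OF that, of u "\<lambda>t. - z t / \<alpha>" "\<lambda>t. - F (u t)"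
              "\<lambda>t. - z' t / \<alpha>"])
          have "u differentiable (at x)" if "x \<in> {t..s}" for x
            using der_u[of x] that \<open>t \<ge> T1\<close> differentiableI_vector by auto
          then show "continuous_on {t..s} u"
            by (auto intro!: continuous_at_imp_continuous_on differentiable_imp_continuous_within)
          have "continuous_on {t..s} z"
            using cont_z[OF \<open>t \<ge> T1\<close>] by (rule continuous_on_subset) auto
          then show "continuous_on {t..s} (\<lambda>t. - z t / \<alpha>)"
            using \<open>\<alpha> > 0\<close> by (intro continuous_intros) auto
          fix x assume x: "t < x" "x < s"
          show "(u has_vector_derivative - F (u x)) (at x)"
            using der_u[of x] x \<open>t \<ge> T1\<close> by auto
          show "((\<lambda>t. - z t / \<alpha>) has_vector_derivative - z' x / \<alpha>) (at x)"
            using DERIV_cdivide[OF DERIV_minus[OF der_z[of x]], of \<alpha>] x \<open>t \<ge> T1\<close>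
            by (simp add: has_real_derivative_iff_has_vector_derivative)
          show "norm (- F (u x)) \<le> - z' x / \<alpha>"
            using z'_F[of x] x \<open>t \<ge> T1\<close> \<open>\<alpha> > 0\<close> by (simp add: field_simps)
        qed
        also have "\<dots> \<le> z t / \<alpha>"
          using z_pos[of s] that \<open>t \<ge> T1\<close> \<open>\<alpha> > 0\<close> by (simp add: field_simps)
        finally show ?thesis
          by (simp add: norm_minus_commute)
      qed
      then show "\<forall>\<^sub>F s in at_top. norm (u t - u s) \<le> z t / \<alpha>"
        by (rule eventually_mono[OF eventually_gt_at_top])
    qed
    have "(z \<longlongrightarrow> 0) at_top"
    proof -
      have "continuous_on {0..<r0} \<phi>" "\<phi> 0 = 0" "r0 > 0"
        using desing by (auto simp: desingularizing_def)
      then have "((\<lambda>t. \<phi> (e t)) \<longlongrightarrow> \<phi> 0) at_top"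
        using e_in by (intro continuous_on_tendsto_compose[OF _ lim_e])
          (force simp: eventually_at_top_linorder)+
      then show ?thesis
        using \<open>\<phi> 0 = 0\<close> by (simp add: z_def[abs_def])
    qed
    \<comment> \<open>This supplies a starting time \<open>T\<close> at which \<open>z\<close> is
      already below \<open>\<nu> 0\<close>.\<close>
    then have "\<forall>\<^sub>F t in at_top. z t < \<nu>0 \<and> T1 \<le> t"
      using \<open>0 < \<nu>0\<close> by (intro eventually_conj order_tendstoD(2)) auto
    then obtain T where T: "z T < \<nu>0" "T1 \<le> T"
      using eventually_happens trivial_limit_at_top_linorder by blast

    \<comment> \<open>Comparison with the one-dimensional system\<close>
    have cont_\<nu>: "continuous_on {0..} \<nu>"
      using assms(20) by (intro DERIV_continuous_on) auto
    have der_\<nu>: "((\<lambda>t. \<nu> (c * (t - T))) has_real_derivative - (c * deriv \<psi> (\<nu> (c * (t - T))))) (at t)"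
      if "t > T" for t
    proof -
      have pos: "c * (t - T) > 0"
        using that \<open>c > 0\<close> by simp
      then have "(\<nu> has_real_derivative - deriv \<psi> (\<nu> (c * (t - T)))) (at (c * (t - T)))"
        using assms(20)[of "c * (t - T)"] at_within_interior[of "c * (t - T)" "{0..}"] by simp
      moreover have "((\<lambda>t. c * (t - T)) has_real_derivative c) (at t)"
        by (auto intro!: derivative_eq_intros)
      ultimately have "((\<lambda>t. \<nu> (c * (t - T))) has_real_derivative
          - deriv \<psi> (\<nu> (c * (t - T))) * c) (at t)"
        by (rule DERIV_chain2)
      then show ?thesis
        by (simp add: mult.commute)
    qed
    \<comment> \<open>The derivative of the difference is at most \<open>c\<close> times
      \<open>deriv \<psi> (\<nu> (c * (t - T))) - deriv \<psi> (z t)\<close>, which is nonpositive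
      wherever \<open>z\<close> exceeds the rescaled \<open>\<nu>\<close>, as
      \<open>deriv \<psi>\<close> is nondecreasing.\<close>
    have z_le: "z t - \<nu> (c * (t - T)) \<le> 0" if "t \<ge> T" for t
    proof (rule deriv_nonpos_where_pos_imp_nonpos[where T = T and w = "\<lambda>t. z t - \<nu> (c * (t - T))"
          and w' = "\<lambda>t. z' t - - (c * deriv \<psi> (\<nu> (c * (t - T))))"])
      show "continuous_on {T..} (\<lambda>t. z t - \<nu> (c * (t - T)))"
        using cont_z[OF T(2)] \<open>c > 0\<close>
        by (intro continuous_intros continuous_on_compose2[OF cont_\<nu>]) auto
      fix t assume t: "T < t"
      show "((\<lambda>t. z t - \<nu> (c * (t - T))) has_real_derivative
          z' t - - (c * deriv \<psi> (\<nu> (c * (t - T))))) (at t)"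
        using der_z[of t] der_\<nu>[OF t] t T by (intro DERIV_diff) auto
      assume gt: "0 < z t - \<nu> (c * (t - T))"
      have \<nu>t: "0 < \<nu> (c * (t - T))" "ereal (\<nu> (c * (t - T))) < a"
        using assms(19)[of "c * (t - T)"] t \<open>c > 0\<close> by auto
      \<comment> \<open>Monotonicity of \<open>deriv \<psi>\<close> is available at values of
        \<open>\<phi>\<close> on \<open>{0<..<r0}\<close>, so \<open>\<nu>\<close> is written as
        \<open>\<phi> y\<close>; its positivity excludes \<open>y = 0\<close>.\<close>
      then have "\<nu> (c * (t - T)) \<in> \<phi> ` {0..<r0}"
        using assms(15) by auto
      then obtain y where y: "y \<in> {0..<r0}" "\<nu> (c * (t - T)) = \<phi> y"
        by auto
      then have "y \<noteq> 0"
        using \<nu>t(1) desing by (auto simp: desingularizing_def)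
      then have "deriv \<psi> (\<nu> (c * (t - T))) \<le> deriv \<psi> (z t)"
        using deriv_the_inv_into_desingularizing_mono[OF desing, of y "e t"] y gt e_in[of t] t T assms(13)
        by (simp add: z_def)
      then have "c * deriv \<psi> (\<nu> (c * (t - T))) \<le> c * deriv \<psi> (z t)"
        using \<open>c > 0\<close> by simp
      then show "z' t - - (c * deriv \<psi> (\<nu> (c * (t - T)))) \<le> 0"
        using z'_\<psi>[of t] t T by simp
    qed (use T \<open>\<nu> 0 = \<nu>0\<close> that in auto)
    \<comment> \<open>The witnesses are \<open>d = 1 / \<alpha>\<close> and
      \<open>t0 = - (c * T)\<close>, the latter absorbing the delayed start.\<close>
    have "norm (u t - u_inf) \<le> 1 / \<alpha> * \<nu> (c * t + - (c * T))" if "t \<ge> T" for t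
    proof -
      have "norm (u t - u_inf) \<le> z t / \<alpha>"
        using dist_z that T by simp
      also have "\<dots> \<le> \<nu> (c * (t - T)) / \<alpha>"
        using z_le[OF that] \<open>\<alpha> > 0\<close> by (simp add: divide_right_mono)
      finally show ?thesis
        by (simp add: algebra_simps)
    qed
    then have "\<forall>\<^sub>F t in at_top. norm (u t - u_inf) \<le> 1 / \<alpha> * \<nu> (c * t + - (c * T))"
      by (auto simp: eventually_at_top_linorder)
    moreover have "1 / \<alpha> > 0"
      using \<open>\<alpha> > 0\<close> by simp
    ultimately show ?thesis
      using \<open>c > 0\<close> by blast
  qed
qed

end
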